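(* Let $1\le K\le N_t$, $M\ge 1$ and $N_r=N_r^xN_r^y\ge 1$ be integers, and let $k\in\{1,\dots,K\}$ and $m\in\{1,\dots,M\}$. Let the path losses $\beta_0,\beta_{1,i},\beta_{2,i}>0$, the Rician factors $K_0,K_1,K_2\ge 0$, the indicators $\omega_i\in\{0,1\}$ ($1\le i\le K$), the power $\bar p_{k,m}>0$, the noise power $\sigma^2>0$, the phase-shift matrix $\mathbf{\Phi}$ and the array response vectors be as in the context, and let $\kappa_i$, $\tau$, $\Xi_{m,i}$ and the average rate $\bar R^{\mathrm{AO}}_{k,m}$ be as defined there. Then $$\bar R^{\mathrm{lb}}_{k,m}=\log_2\left(1+\frac{\bar p_{k,m}\exp\left(\psi(N_t-K+1)\right)\kappa_k}{\sigma^2}\right)$$ is a lower bound of $\bar R^{\mathrm{AO}}_{k,m}$, that is, $\bar R^{\mathrm{AO}}_{k,m}\ge \bar R^{\mathrm{lb}}_{k,m}$.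
   Context: $\psi$ is the digamma function. $K$ is the number of users, $M$ the number of subcarriers, $N_t$ the number of base station antennas, $N_r$ the number of elements of the reconfigurable intelligent surface (RIS). $\beta_0,\beta_{1,i},\beta_{2,i}$ are path losses and $K_0,K_1,K_2$ are Rician factors of the BS-RIS, BS-user $i$ and RIS-user $i$ links respectively; $\omega_i$ indicates whether user $i$ is served by the RIS. $\mathbf{\Phi}=\mathrm{diag}(\theta_1,\dots,\theta_{N_r})$ with $\theta_n\in\mathbb{C}$, $|\theta_n|=1$. For real $\vartheta^a,\vartheta^e$, the planar array response is the row vector $\mathbf a(\vartheta^a,\vartheta^e)=\frac{1}{\sqrt{N_r}}[1,e^{j2\pi\vartheta^a},\dots,e^{j2\pi(N_r^x-1)\vartheta^a}]\otimes[1,e^{j2\pi\vartheta^e},\dots,e^{j2\pi(N_r^y-1)\vartheta^e}]\in\mathbb{C}^{1\times N_r}$. Given real spatial directions $\theta^a_{0,m},\theta^e_{0,m}$ and $\theta^a_{2,i,m},\theta^e_{2,i,m}$, put $\mathbf a_{0,m}=\mathbf a(\theta^a_{0,m},\theta^e_{0,m})$ and $\bar{\mathbf h}_{i,m}=\mathbf a(\theta^a_{2,i,m},\theta^e_{2,i,m})^H\in\mathbb{C}^{N_r\times 1}$. Definitions: $$\kappa_i=\beta_{1,i}+\frac{\omega_i(K_0+K_2+1)\beta_0\beta_{2,i}}{(K_0+1)(K_2+1)}+\frac{K_1\beta_{1,i}}{N_t(K_1+1)},\qquad \tau=\frac{K_0K_2}{N_t(K_0+1)(K_2+1)},$$ $$\Xi_{m,i}=\omega_i\sqrt{\beta_0\beta_{2,i}}\;\bar{\mathbf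 h}_{i,m}^H\mathbf{\Phi}^H\mathbf a_{0,m}^H\in\mathbb{C},$$ $$\bar R^{\mathrm{AO}}_{k,m}=\log_2\left(1+\frac{\bar p_{k,m}\exp(\psi(N_t-K+1))\,\kappa_k}{\sigma^2}\left(1+\frac{\tau\frac{|\Xi_{m,k}|^2}{\kappa_k}}{1+\tau\sum_{i\ne k}\frac{|\Xi_{m,i}|^2}{\kappa_i}}\right)\right),$$ where the sum is over $i\in\{1,\dots,K\}\setminus\{k\}$. *)

theory Defs
  imports
    "HOL-Analysis.Gamma_Function"
    "Jordan_Normal_Form.Schur_Decomposition"
begin

definition kronecker :: "complex mat \<Rightarrow> complex mat \<Rightarrow> complex mat" where
  "kronecker A B =
     mat (dim_row A * dim_row B) (dim_col A * dim_col B)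
       (\<lambda>(i, j). A $$ (i div dim_row B, j div dim_col B) * B $$ (i mod dim_row B, j mod dim_col B))"

definition steering_row :: "nat \<Rightarrow> real \<Rightarrow> complex mat" where
  "steering_row n v = mat 1 n (\<lambda>(_, l). cis (2 * pi * real l * v))"

definition array_response :: "nat \<Rightarrow> nat \<Rightarrow> real \<Rightarrow> real \<Rightarrow> complex mat" where
  "array_response Nrx Nry va ve =
     complex_of_real (1 / sqrt (real (Nrx * Nry))) \<cdot>\<^sub>m
       kronecker (steering_row Nrx va) (steering_row Nry ve)"

text \<open>The phase shifts are numbered from 1, whereas matrix indices start at 0.\<close>

definition phase_shift_mat :: "nat \<Rightarrow> (nat \<Rightarrow> complex) \<Rightarrow> complex mat" where
  "phase_shift_mat Nr \<theta> = mat Nr Nr (\<lambda>(i, j). if i = j then \<theta> (i + 1) else 0)"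

text \<open>
  In the definitions below \<open>Nt\<close> is the number of base station antennas; \<open>K0\<close>, \<open>K1\<close>, \<open>K2\<close> are the
  Rician factors and \<open>\<beta>0\<close>, \<open>\<beta>1 i\<close>, \<open>\<beta>2 i\<close> the path losses of the links from the base station to
  the RIS, from the base station to user \<open>i\<close>, and from the RIS to user \<open>i\<close>; \<open>\<omega> i\<close> is the RIS
  service indicator of user \<open>i\<close>.
\<close>

definition kappa_coeff ::
  "nat \<Rightarrow> real \<Rightarrow> real \<Rightarrow> real \<Rightarrow> real \<Rightarrow> (nat \<Rightarrow> real) \<Rightarrow> (nat \<Rightarrow> real) \<Rightarrow> (nat \<Rightarrow> real) \<Rightarrow> nat \<Rightarrow> real"
  where
  "kappa_coeff Nt K0 K1 K2 \<beta>0 \<beta>1 \<beta>2 \<omega> i =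
     \<beta>1 i + \<omega> i * (K0 + K2 + 1) * \<beta>0 * \<beta>2 i / ((K0 + 1) * (K2 + 1))
       + K1 * \<beta>1 i / (real Nt * (K1 + 1))"

definition tau_coeff :: "nat \<Rightarrow> real \<Rightarrow> real \<Rightarrow> real" where
  "tau_coeff Nt K0 K2 = K0 * K2 / (real Nt * (K0 + 1) * (K2 + 1))"

text \<open>
  Here \<open>h\<close> is the column vector of the RIS-user link and \<open>a0\<close> the row vector of the
  BS-RIS link; the matrix product is \<open>1 \<times> 1\<close> and is identified with its only entry.
\<close>

definition Xi_coeff ::
  "real \<Rightarrow> real \<Rightarrow> real \<Rightarrow> complex mat \<Rightarrow> complex mat \<Rightarrow> complex mat \<Rightarrow> complex" where
  "Xi_coeff w b0 b2 h \<Phi> a0 =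
     complex_of_real (w * sqrt (b0 * b2)) * ((mat_adjoint h * mat_adjoint \<Phi> * mat_adjoint a0) $$ (0, 0))"

text \<open>
  The rate of user \<open>k\<close> on one subcarrier, with transmit power \<open>p\<close> and noise power \<open>\<sigma>\<^sup>2\<close>; \<open>\<Xi>\<close> is the
  family of the coefficients of the users \<open>1, \<dots>, K\<close> on that subcarrier.
\<close>

definition avg_rate_AO ::
  "nat \<Rightarrow> nat \<Rightarrow> real \<Rightarrow> real \<Rightarrow> real \<Rightarrow> (nat \<Rightarrow> real) \<Rightarrow> (nat \<Rightarrow> complex) \<Rightarrow> nat \<Rightarrow> real" where
  "avg_rate_AO Nt K p \<sigma> \<tau> \<kappa> \<Xi> k =
     log 2 (1 + p * exp (Digamma (real Nt - real K + 1)) * \<kappa> k / \<sigma>\<^sup>2 *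
       (1 + \<tau> * ((cmod (\<Xi> k))\<^sup>2 / \<kappa> k) /
              (1 + \<tau> * (\<Sum>i\<in>{1..K} - {k}. (cmod (\<Xi> i))\<^sup>2 / \<kappa> i))))"

end

theory Submission
  imports Defs
begin

text \<open>The rate has the form log2 (1 + snr * (1 + gain)), and the bound is the same expression
  with gain = 0. Here snr is the factor common to both sides, and gain collects everything that
  depends on the coefficients \<Xi>. These enter only through squared moduli, weighted by \<tau> and
  by 1 / \<kappa> i, so gain is a quotient of nonnegative terms as soon as \<tau> and all \<kappa> i
  are nonnegative. The signs come from \<open>kappa_coeff_pos\<close> and
  \<open>tau_coeff_nonneg\<close>; monotonicity of the logarithm then gives
  \<open>avg_rate_AO_lower_bound\<close>.\<close>

text \<open>Strictness comes from the direct-link summand \<beta>1 i alone; the other two summands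
  are only nonnegative, and the RIS one vanishes when \<omega> i = 0.\<close>

lemma kappa_coeff_pos:
  assumes "K0 \<ge> 0" "K1 \<ge> 0" "K2 \<ge> 0" "\<beta>0 \<ge> 0" "\<beta>1 i > 0" "\<beta>2 i \<ge> 0" "\<omega> i \<ge> 0"
  shows "kappa_coeff Nt K0 K1 K2 \<beta>0 \<beta>1 \<beta>2 \<omega> i > 0"
  unfolding kappa_coeff_def using assms
  by (intro add_pos_nonneg divide_nonneg_nonneg mult_nonneg_nonneg) auto

lemma tau_coeff_nonneg:
  assumes "K0 \<ge> 0" "K2 \<ge> 0"
  shows "tau_coeff Nt K0 K2 \<ge> 0"
  unfolding tau_coeff_def using assms by simp

text \<open>This is the analytic core, with \<kappa>, \<tau> and \<Xi> abstract. Weak inequalities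
  suffice because division by zero yields 0, so all quotients stay nonnegative.\<close>

lemma avg_rate_AO_lower_bound:
  assumes "p \<ge> 0" "\<tau> \<ge> 0" "k \<in> {1..K}" and \<kappa>: "\<And>i. i \<in> {1..K} \<Longrightarrow> \<kappa> i \<ge> 0"
  shows "log 2 (1 + p * exp (Digamma (real Nt - real K + 1)) * \<kappa> k / \<sigma>\<^sup>2)
       \<le> avg_rate_AO Nt K p \<sigma> \<tau> \<kappa> \<Xi> k"
proof -
  define snr where "snr = p * exp (Digamma (real Nt - real K + 1)) * \<kappa> k / \<sigma>\<^sup>2"
  define gain where "gain = \<tau> * ((cmod (\<Xi> k))\<^sup>2 / \<kappa> k) /
    (1 + \<tau> * (\<Sum>i\<in>{1..K} - {k}. (cmod (\<Xi> i))\<^sup>2 / \<kappa> i))"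
  \<comment> \<open>The exponential is positive whatever the value of \<open>Digamma\<close>, so the
    sign is decided by \<open>p\<close> and \<kappa> k.\<close>
  have "snr \<ge> 0"
    unfolding snr_def using assms by simp
  moreover have "(\<Sum>i\<in>{1..K} - {k}. (cmod (\<Xi> i))\<^sup>2 / \<kappa> i) \<ge> 0"
    using \<kappa> by (intro sum_nonneg) simp
  then have "gain \<ge> 0"
    unfolding gain_def using assms by (intro divide_nonneg_nonneg mult_nonneg_nonneg add_nonneg_nonneg) auto
  \<comment> \<open>The two sides differ by snr * gain. Since 1 + snr is positive, the inequality
    passes through the logarithm.\<close>
  ultimately have "1 + snr \<le> 1 + snr * (1 + gain)"
    by (simp add: distrib_left)
  with \<open>snr \<ge> 0\<close> show ?thesis
    unfolding avg_rate_AO_def by (fold snr_def gain_def) simp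
qed

theorem corollary1:
  fixes K Nt M Nrx Nry Nr k m :: nat
    and \<beta>0 K0 K1 K2 \<sigma> :: real
    and \<beta>1 \<beta>2 \<omega> :: "nat \<Rightarrow> real"
    and p :: "nat \<Rightarrow> nat \<Rightarrow> real"
    and \<theta> :: "nat \<Rightarrow> complex"
    and \<theta>0a \<theta>0e :: "nat \<Rightarrow> real"
    and \<theta>2a \<theta>2e :: "nat \<Rightarrow> nat \<Rightarrow> real"
    and \<Phi> :: "complex mat"
    and a0 :: "nat \<Rightarrow> complex mat"
    and h :: "nat \<Rightarrow> nat \<Rightarrow> complex mat"
    and \<kappa> :: "nat \<Rightarrow> real"
    and \<tau> :: real
    and \<Xi> :: "nat \<Rightarrow> nat \<Rightarrow> complex"
  defines "\<Phi> \<equiv> phase_shift_mat Nr \<theta>"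
    and "a0 \<equiv> \<lambda>m. array_response Nrx Nry (\<theta>0a m) (\<theta>0e m)"
    and "h \<equiv> \<lambda>i m. mat_adjoint (array_response Nrx Nry (\<theta>2a i m) (\<theta>2e i m))"
    and "\<kappa> \<equiv> kappa_coeff Nt K0 K1 K2 \<beta>0 \<beta>1 \<beta>2 \<omega>"
    and "\<tau> \<equiv> tau_coeff Nt K0 K2"
    and "\<Xi> \<equiv> \<lambda>m i. Xi_coeff (\<omega> i) \<beta>0 (\<beta>2 i) (h i m) \<Phi> (a0 m)"
  assumes "1 \<le> K" and "K \<le> Nt"
    and "M \<ge> 1"
    and "Nr = Nrx * Nry" and "Nr \<ge> 1"
    and "k \<in> {1..K}" and "m \<in> {1..M}"
    and "\<beta>0 > 0"
    and "\<And>i. i \<in> {1..K} \<Longrightarrow> \<beta>1 i > 0"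
    and "\<And>i. i \<in> {1..K} \<Longrightarrow> \<beta>2 i > 0"
    and "K0 \<ge> 0" and "K1 \<ge> 0" and "K2 \<ge> 0"
    and "\<And>i. i \<in> {1..K} \<Longrightarrow> \<omega> i \<in> {0, 1}"
    and "p k m > 0"
    and "\<sigma>\<^sup>2 > 0"
    and "\<And>n. n \<in> {1..Nr} \<Longrightarrow> cmod (\<theta> n) = 1"
  shows "avg_rate_AO Nt K (p k m) \<sigma> \<tau> \<kappa> (\<Xi> m) k
       \<ge> log 2 (1 + p k m * exp (Digamma (real Nt - real K + 1)) * \<kappa> k / \<sigma>\<^sup>2)"
proof -
  \<comment> \<open>All users are needed, not just \<open>k\<close>: the other \<kappa> i occur in
    the denominator of the gain.\<close>
  have "\<kappa> i \<ge> 0" if "i \<in> {1..K}" for i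
  proof -
    have "\<omega> i \<ge> 0"
      using \<open>i \<in> {1..K} \<Longrightarrow> \<omega> i \<in> {0, 1}\<close> that by auto
    then show ?thesis
      unfolding \<kappa>_def using assms that by (intro order.strict_implies_order[OF kappa_coeff_pos]) (simp_all add: less_imp_le)
  qed
  moreover have "\<tau> \<ge> 0"
    unfolding \<tau>_def using \<open>K0 \<ge> 0\<close> \<open>K2 \<ge> 0\<close> by (rule tau_coeff_nonneg)
  ultimately show ?thesis
    using \<open>p k m > 0\<close> \<open>k \<in> {1..K}\<close> by (intro avg_rate_AO_lower_bound) auto
qed

end
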